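(* Let $\ell\ge2$. For $m\ge1$ let $\psi_m:\mathbb R^m\to\mathbb R^m$ be the affine map $\psi_m(a_1,\dots,a_m)=(a_m+1,a_1,a_2,\dots,a_{m-1})$. Let $(a_1,\dots,a_\ell)\in\mathbb Z^\ell$ with $\sum_j a_j=0$, and let $k$ be the first part of the $\ell$-core $\pi(a_1,\dots,a_\ell)$. Then $$\pi^{-1}\circ\Phi_\ell^k\circ\pi(a_1,\dots,a_\ell)=\psi_{\ell-1}^{a_i}(a_1,\dots,\widehat{a_i},\dots,a_\ell),$$ where $a_i$ is the rightmost occurrence of the largest entry among $\{a_1,\dots,a_\ell\}$, the circumflex indicates omission, and the exponent $a_i$ denotes iteration.
   Context: An $\ell$-core is a partition with no hook length divisible by $\ell$. $\mathcal C_\ell^k$ is the set of $\ell$-cores with first part $k$, and $\mathcal C_{\ell-1}^{\le k}$ the set of $(\ell-1)$-cores with first part $\le k$. Abaci. An ($\ell$-)abacus has runners (columns) $0,\dots,\ell-1$ and levels (rows) $r\in\mathbb Z$; the entry on runner $j$, level $r$ is the integer $r\ell+j$. Some entries are beads, the others gaps, such that all sufficiently small integers are beads and all sufficiently large ones are gaps. An abacus determines a partition: its parts are, for each bead, the number of gaps preceding it in the linear order of the integers (discarding zeros). An abacus is flush if on every runner no bead is preceded by a gap of the same runner; it is balanced if the sum over all runners of the largest level containing a bead is $0$. A partition is an $\ell$-core iff its abaci are flush, and each $\ell$-core has exactly one balanced flush abacus. $\pi$ is the bijection from $\{(a_1,\dots,a_\ell)\in\mathbb Z^\ell:\sum a_j=0\}$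 to the set of $\ell$-cores sending $(a_1,\dots,a_\ell)$ to the partition of the balanced flush $\ell$-abacus whose runner $j-1$ has beads exactly at levels $\le a_j$, $1\le j\le\ell$. The same letter $\pi$ is used for $\ell-1$ in place of $\ell$ (so $\pi^{-1}$ in the claim takes $(\ell-1)$-cores to vectors in $\mathbb Z^{\ell-1}$ with sum $0$). $\Phi_\ell^k:\mathcal C_\ell^k\to\mathcal C_{\ell-1}^{\le k}$ is the bijection: given any abacus of $\lambda\in\mathcal C_\ell^k$, delete the whole runner containing the largest bead, and place the remaining runners in order (levels unchanged) into an $(\ell-1)$-abacus; $\Phi_\ell^k(\lambda)$ is the corresponding $(\ell-1)$-core (independent of the choice of abacus). *)

theory Defs
  imports Complex_Main "HOL-Library.FuncSet"
begin

section \<open>Partitions and cores\<close>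

definition is_partition :: "nat list \<Rightarrow> bool" where
  "is_partition p \<longleftrightarrow> sorted_wrt (\<ge>) p \<and> 0 \<notin> set p"

definition first_part :: "nat list \<Rightarrow> nat" where
  "first_part p = (case p of [] \<Rightarrow> 0 | x # _ \<Rightarrow> x)"

text \<open>Rows and columns of the Young diagram are numbered from 0; the summands are arm, leg and 1.\<close>
definition hook_length :: "nat list \<Rightarrow> nat \<Rightarrow> nat \<Rightarrow> nat" where
  "hook_length p i j =
     (p ! i - Suc j) + card {i'. i < i' \<and> i' < length p \<and> j < p ! i'} + 1"

definition is_core :: "nat \<Rightarrow> nat list \<Rightarrow> bool" where
  "is_core l p \<longleftrightarrow>
     is_partition p \<and> (\<forall>i<length p. \<forall>j<p ! i. \<not> l dvd hook_length p i j)"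

definition cores_first :: "nat \<Rightarrow> nat \<Rightarrow> nat list set" where
  "cores_first l k = {p. is_core l p \<and> first_part p = k}"


section \<open>Abaci\<close>

text \<open>An abacus is given by its set of beads; the number of runners only enters through the
  coordinates (level, runner) of an integer.\<close>
definition is_abacus :: "int set \<Rightarrow> bool" where
  "is_abacus B \<longleftrightarrow> (\<exists>m. \<forall>x\<le>m. x \<in> B) \<and> (\<exists>M. \<forall>x\<ge>M. x \<notin> B)"

definition entry :: "nat \<Rightarrow> int \<Rightarrow> nat \<Rightarrow> int" where
  "entry l r j = r * int l + int j"

definition gaps_before :: "int set \<Rightarrow> int \<Rightarrow> nat" where
  "gaps_before B b = card {g. g < b \<and> g \<notin> B}"

text \<open>Beads are listed from the largest downwards, so that the parts come out weakly
  decreasing.\<close>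
definition partition_of :: "int set \<Rightarrow> nat list" where
  "partition_of B =
     map (gaps_before B) (rev (sorted_list_of_set {b \<in> B. gaps_before B b \<noteq> 0}))"

text \<open>The remaining runners keep their order and levels, hence runners to the right of \<open>d\<close>
  move one place to the left.\<close>
definition delete_runner :: "nat \<Rightarrow> nat \<Rightarrow> int set \<Rightarrow> int set" where
  "delete_runner l d B =
     {entry (l - 1) r j | r j. j < l - 1 \<and> entry l r (if j < d then j else Suc j) \<in> B}"

definition largest_bead :: "int set \<Rightarrow> int" where
  "largest_bead B = (GREATEST b. b \<in> B)"

definition delete_max_runner :: "nat \<Rightarrow> int set \<Rightarrow> int set" where
  "delete_max_runner l B = delete_runner l (nat (largest_bead B mod int l)) B"


section \<open>The maps\<close>

text \<open>Vectors are lists, the dimension being the length; the entry with 0-based index \<open>j\<close>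
  belongs to runner \<open>j\<close>.\<close>
definition zero_sum_vectors :: "nat \<Rightarrow> int list set" where
  "zero_sum_vectors l = {a. length a = l \<and> sum_list a = 0}"

text \<open>By construction this abacus is flush, and \<open>a ! j\<close> is the largest level of a bead on
  runner \<open>j\<close>; so it is balanced if and only if the entries of \<open>a\<close> sum to 0.\<close>
definition vec_abacus :: "int list \<Rightarrow> int set" where
  "vec_abacus a = {entry (length a) r j | r j. j < length a \<and> r \<le> a ! j}"

text \<open>The map written \<open>\<pi>\<close> in the literature, for all dimensions at once.\<close>
definition vec_core :: "int list \<Rightarrow> nat list" where
  "vec_core a = partition_of (vec_abacus a)"

definition core_vec :: "nat \<Rightarrow> nat list \<Rightarrow> int list" where
  "core_vec l = the_inv_into (zero_sum_vectors l) vec_core"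

text \<open>The description by \<open>THE\<close> expresses that the result does not depend on the abacus \<open>B\<close>
  chosen for \<open>p\<close>.\<close>
definition Phi :: "nat \<Rightarrow> nat \<Rightarrow> nat list \<Rightarrow> nat list" where
  "Phi l k =
     (\<lambda>p\<in>cores_first l k.
        THE q. \<exists>B. is_abacus B \<and> partition_of B = p \<and> q = partition_of (delete_max_runner l B))"

definition psi :: "real list \<Rightarrow> real list" where
  "psi x = (last x + 1) # butlast x"

end

theory Submission
  imports Defs
begin

text \<open>
  If \<open>m\<close> is the least gap of an abacus with partition \<open>p\<close> of length \<open>n\<close>, then its beads are the
  integers below \<open>m\<close> together with the integers \<open>p\<^sub>i + m + n - 1 - i\<close>. Hence two abaci have the
  same partition iff they are shifts of each other. Deleting the runner of the largest bead commutes
  with shifts up to another shift, so \<open>\<Phi>\<close> may be computed on the balanced abacus, where it removes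
  the entry \<open>a\<^sub>i\<close>. The remaining vector has sum \<open>- a\<^sub>i\<close>. Since \<open>\<psi>\<close> shifts the abacus of a vector
  by one and raises the sum by one, \<open>a\<^sub>i\<close> applications of it give the balanced abacus of the same core.
\<close>

section \<open>Shifts of bead sets\<close>

lemma mem_shift_iff:
  fixes s x :: int
  shows "x \<in> (+) s ` X \<longleftrightarrow> x - s \<in> X"
  by (auto simp: image_iff intro: bexI[of _ "x - s"])

lemma gaps_before_shift: "gaps_before ((+) s ` B) (s + b) = gaps_before B b"
proof -
  have "{g. g < s + b \<and> g \<notin> (+) s ` B} = (+) s ` {g. g < b \<and> g \<notin> B}"
    by (auto simp only: set_eq_iff mem_Collect_eq mem_shift_iff less_diff_eq diff_less_eq add.commute)
  then show ?thesis
    by (simp add: gaps_before_def card_image)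
qed

lemma sorted_list_of_set_shift:
  fixes S :: "int set"
  assumes "finite S"
  shows "sorted_list_of_set ((+) s ` S) = map ((+) s) (sorted_list_of_set S)"
proof (rule sorted_distinct_set_unique)
  show "sorted (map ((+) s) (sorted_list_of_set S))"
    by (simp add: sorted_map)
qed (use assms in \<open>auto simp: distinct_map\<close>)

section \<open>The least gap, and recovering an abacus from its partition\<close>

lemma abacus_least_gap:
  assumes "is_abacus B"
  obtains m where "m \<notin> B" "\<And>x. x < m \<Longrightarrow> x \<in> B" "finite {b \<in> B. m < b}"
proof -
  obtain m0 M where m0: "\<And>x. x \<le> m0 \<Longrightarrow> x \<in> B" and M: "\<And>x. x \<ge> M \<Longrightarrow> x \<notin> B"
    using assms unfolding is_abacus_def by blast
  have "m0 < M"
    using m0[of M] M[of M] by linarith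
  \<comment> \<open>Counting upwards from \<open>m0\<close>, below which there are only beads, turns
    the search for the least gap into a \<open>LEAST\<close> over the naturals.\<close>
  define N where "N = (LEAST n. m0 + int n \<notin> B)"
  have "m0 + int (nat (M - m0)) \<notin> B"
    using M \<open>m0 < M\<close> by simp
  then have N: "m0 + int N \<notin> B"
    unfolding N_def by (rule LeastI)
  have "x \<in> B" if "x < m0 + int N" for x
  proof (cases "x \<le> m0")
    case False
    then have "nat (x - m0) < N"
      using that by linarith
    then have "m0 + int (nat (x - m0)) \<in> B"
      unfolding N_def using not_less_Least by blast
    then show ?thesis
      using False by simp
  qed (rule m0)
  moreover have "b \<in> {m0..M}" if "b \<in> B" "m0 + int N < b" for b
    using M[of b] that by (cases "b \<le> M") auto
  then have "{b \<in> B. m0 + int N < b} \<subseteq> {m0..M}"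
    by blast
  then have "finite {b \<in> B. m0 + int N < b}"
    by (rule finite_subset) simp
  ultimately show ?thesis
    using that N by blast
qed

text \<open>An abacus together with its least gap \<open>m\<close>. The beads below \<open>m\<close>
  have no gap before them, so the partition sees only the finitely many beads above
  \<open>m\<close>.\<close>

locale abacus_gap =
  fixes B :: "int set" and m :: int
  assumes gap: "m \<notin> B"
    and below: "\<And>x. x < m \<Longrightarrow> x \<in> B"
    and finite_above: "finite {b \<in> B. m < b}"
begin

lemma gap_ge: "g \<notin> B \<Longrightarrow> m \<le> g"
  using below by (meson linorder_not_le)

lemma finite_gaps: "finite {g. g < b \<and> g \<notin> B}"
  by (rule finite_subset[of _ "{m..b}"]) (auto dest: gap_ge)

lemma beads_after_gap: "{b \<in> B. gaps_before B b \<noteq> 0} = {b \<in> B. m < b}"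
proof -
  have "gaps_before B b \<noteq> 0 \<longleftrightarrow> m < b" if "b \<in> B" for b
    unfolding gaps_before_def using finite_gaps[of b] gap by (auto dest: gap_ge)
  then show ?thesis
    by auto
qed

text \<open>All gaps below \<open>b\<close> lie in \<open>{m..<b}\<close>, so they are what the
  beads leave over from these \<open>b - m\<close> integers.\<close>

lemma gaps_before_eq:
  assumes "m < b"
  shows "int (gaps_before B b) = b - m - int (card {x \<in> B. m < x \<and> x < b})"
proof -
  have "{m..<b} = {g. g < b \<and> g \<notin> B} \<union> {x \<in> B. m < x \<and> x < b}"
    using gap by (auto dest: gap_ge simp: order_le_less)
  moreover have "finite {x \<in> B. m < x \<and> x < b}"
    by (rule finite_subset[OF _ finite_above]) auto
  then have "card ({g. g < b \<and> g \<notin> B} \<union> {x \<in> B. m < x \<and> x < b})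
      = gaps_before B b + card {x \<in> B. m < x \<and> x < b}"
    unfolding gaps_before_def by (intro card_Un_disjoint finite_gaps) auto
  ultimately have "nat (b - m) = gaps_before B b + card {x \<in> B. m < x \<and> x < b}"
    by (metis card_atLeastLessThan_int)
  then show ?thesis
    using assms by linarith
qed

abbreviation beads :: "int list" where
  "beads \<equiv> rev (sorted_list_of_set {b \<in> B. m < b})"

lemma partition_of_eq: "partition_of B = map (gaps_before B) beads"
  by (simp only: partition_of_def beads_after_gap)

lemma length_partition_of: "length (partition_of B) = length beads"
  by (simp add: partition_of_eq)

lemma beads_nth_less_iff:
  assumes "i < length beads" "j < length beads"
  shows "beads ! i < beads ! j \<longleftrightarrow> j < i"
proof -
  have "sorted_wrt (>) beads"
    by (simp add: sorted_wrt_rev)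
  then have "s < t \<Longrightarrow> t < length beads \<Longrightarrow> beads ! t < beads ! s" for s t
    by (rule sorted_wrt_nth_less)
  from this[of i j] this[of j i] show ?thesis
    using assms by (cases i j rule: linorder_cases) auto
qed

lemma beads_in: "i < length beads \<Longrightarrow> beads ! i \<in> B \<and> m < beads ! i"
  using nth_mem[of i beads] finite_above by simp

text \<open>\<open>beads\<close> is decreasing, so the beads between \<open>m\<close> and the one
  with index \<open>i\<close> are exactly those with a larger index. Their number turns
  \<open>gaps_before_eq\<close> into an equation that can be solved for the bead.\<close>

lemma beads_nth:
  assumes i: "i < length beads"
  shows "beads ! i = int (partition_of B ! i) + m + int (length beads) - 1 - int i"
proof -
  have set: "set beads = {b \<in> B. m < b}"
    using finite_above by simp
  have "{x \<in> B. m < x \<and> x < beads ! i} = (!) beads ` {i<..<length beads}"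
  proof (intro equalityI subsetI)
    fix x assume x: "x \<in> {x \<in> B. m < x \<and> x < beads ! i}"
    then obtain j where "j < length beads" "beads ! j = x"
      using set by (metis (mono_tags, lifting) in_set_conv_nth mem_Collect_eq)
    then show "x \<in> (!) beads ` {i<..<length beads}"
      using x beads_nth_less_iff[of j i] i by auto
  next
    fix x assume "x \<in> (!) beads ` {i<..<length beads}"
    then obtain j where j: "i < j" "j < length beads" "x = beads ! j"
      by auto
    then show "x \<in> {x \<in> B. m < x \<and> x < beads ! i}"
      using beads_nth_less_iff[of j i] beads_in[of j] i by blast
  qed
  moreover have "inj_on ((!) beads) {i<..<length beads}"
    by (intro inj_on_nth) auto
  ultimately have "card {x \<in> B. m < x \<and> x < beads ! i} = length beads - Suc i"
    by (simp add: card_image)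
  moreover have "m < beads ! i"
    using beads_in i by blast
  moreover have "partition_of B ! i = gaps_before B (beads ! i)"
    using i by (simp add: partition_of_eq)
  ultimately show ?thesis
    using gaps_before_eq[of "beads ! i"] i by linarith
qed

text \<open>The right-hand side depends on \<open>B\<close> only through its partition and
  \<open>m\<close>, and \<open>m\<close> enters as an additive constant. This is what makes an
  abacus recoverable up to a shift.\<close>

lemma abacus_eq_partition:
  "B = {..<m} \<union> (\<lambda>i. int (partition_of B ! i) + m + int (length (partition_of B)) - 1 - int i)
         ` {..<length (partition_of B)}"
proof -
  have "x \<in> B \<longleftrightarrow> x < m \<or> x \<in> B \<and> m < x" for x
    using below[of x] gap by (cases x m rule: linorder_cases) auto
  then have "B = {..<m} \<union> {b \<in> B. m < b}"
    by blast
  also have "{b \<in> B. m < b} = set beads"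
    using finite_above by simp
  also have "set beads = (!) beads ` {..<length beads}"
    by (auto simp: set_conv_nth)
  also have "\<dots> = (\<lambda>i. int (partition_of B ! i) + m + int (length (partition_of B)) - 1 - int i)
      ` {..<length (partition_of B)}"
    unfolding length_partition_of by (intro image_cong refl beads_nth) simp
  finally show ?thesis .
qed

lemma is_partition_partition_of: "is_partition (partition_of B)"
proof -
  have "gaps_before B x \<le> gaps_before B y" if "x \<le> y" for x y
    unfolding gaps_before_def by (intro card_mono finite_gaps) (use that in auto)
  moreover have "sorted_wrt (\<ge>) beads"
    by (simp add: sorted_wrt_rev)
  ultimately have "sorted_wrt (\<ge>) (partition_of B)"
    unfolding partition_of_eq sorted_wrt_map using sorted_wrt_mono_rel by (metis (mono_tags, lifting))
  moreover have "finite {b \<in> B. gaps_before B b \<noteq> 0}"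
    using finite_above by (simp only: beads_after_gap)
  then have "0 \<notin> set (partition_of B)"
    unfolding partition_of_def by auto
  ultimately show ?thesis
    by (simp add: is_partition_def)
qed

text \<open>A hook length is the distance from the bead of its row down to the gap of its column.\<close>
lemma hook_length_bead_gap:
  assumes i: "i < length (partition_of B)" and j: "j < partition_of B ! i"
  shows "\<exists>b\<in>B. b - int (hook_length (partition_of B) i j) \<notin> B"
proof -
  define p where "p = partition_of B"
  define n where "n = length p"
  \<comment> \<open>\<open>D\<close> consists of the rows that meet column \<open>j\<close>. Parts
    decrease weakly, so \<open>D\<close> is an initial segment and \<open>L\<close> is the length of
    the column.\<close>
  define D where "D = {t. t < n \<and> j < p ! t}"
  define L where "L = card D"
  have sorted: "p ! t \<le> p ! s" if "s \<le> t" "t < n" for s t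
  proof (cases "s = t")
    case False
    then show ?thesis
      using is_partition_partition_of that
      unfolding is_partition_def p_def[symmetric] n_def
      by (metis order_le_less sorted_wrt_nth_less)
  qed simp
  have D: "D = {..<L}"
  proof -
    have "finite D"
      unfolding D_def by simp
    have closed: "s \<in> D" if "t \<in> D" "s \<le> t" for s t
      using that sorted[of s t] unfolding D_def by auto
    have "D = {..<(LEAST t. t \<notin> D)}"
    proof (intro equalityI subsetI)
      fix t assume "t \<in> D"
      moreover have "(LEAST t. t \<notin> D) \<notin> D"
        by (rule LeastI[of _ n]) (simp add: D_def)
      ultimately show "t \<in> {..<(LEAST t. t \<notin> D)}"
        using closed by (meson lessThan_iff linorder_not_le)
    next
      fix t assume "t \<in> {..<(LEAST t. t \<notin> D)}"
      then show "t \<in> D"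
        using not_less_Least by blast
    qed
    then show ?thesis
      unfolding L_def by (metis card_lessThan)
  qed
  have D_iff: "t < n \<and> j < p ! t \<longleftrightarrow> t < L" for t
    using D unfolding D_def by blast
  have "{i'. i < i' \<and> i' < length p \<and> j < p ! i'} = {i<..<L}"
    using D_iff unfolding n_def set_eq_iff mem_Collect_eq greaterThanLessThan_iff by blast
  moreover have "i < L"
    using D_iff[of i] i j by (simp add: p_def n_def)
  ultimately have hook: "int (hook_length p i j) = int (p ! i) - int j + int L - int i - 1"
    unfolding hook_length_def using j by (simp add: p_def)
  \<comment> \<open>The witness is the bead of row \<open>i\<close>, at the position given by
    \<open>beads_nth\<close>.\<close>
  define b where "b = int (p ! i) + m + int n - 1 - int i"
  have B: "B = {..<m} \<union> (\<lambda>i. int (p ! i) + m + int n - 1 - int i) ` {..<n}"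
    using abacus_eq_partition unfolding p_def n_def .
  have "b \<in> B"
    using i unfolding b_def p_def[symmetric] n_def[symmetric] by (subst B) auto
  moreover have diff: "b - int (hook_length p i j) = m + int n + int j - int L"
    using hook by (simp add: b_def)
  have "L \<le> n"
    using D_iff[of n] by simp
  \<comment> \<open>Since \<open>L \<le> n\<close>, this position is at least \<open>m\<close>, so a
    bead there would belong to some row \<open>t\<close>. Then \<open>p ! t = j + 1 + t - L\<close>,
    which exceeds \<open>j\<close> exactly when \<open>t \<ge> L\<close>, contrary to
    \<open>D_iff\<close>.\<close>
  have "b - int (hook_length p i j) \<notin> B"
  proof
    assume "b - int (hook_length p i j) \<in> B"
    then obtain t where t: "t < n" "m + int n + int j - int L = int (p ! t) + m + int n - 1 - int t"
      using \<open>L \<le> n\<close> unfolding diff by (subst (asm) B) auto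
    show False
      using D_iff[of t] t by linarith
  qed
  ultimately show ?thesis
    unfolding p_def by blast
qed

end

section \<open>Abaci with equal partitions, and flush abaci\<close>

lemma is_abacus_imp_gap:
  assumes "is_abacus B"
  obtains m where "abacus_gap B m"
  using abacus_least_gap[OF assms] by (metis abacus_gap.intro)

lemma partition_of_shift:
  assumes "is_abacus B"
  shows "partition_of ((+) s ` B) = partition_of B"
proof -
  obtain m where "abacus_gap B m"
    using is_abacus_imp_gap[OF assms] .
  then interpret abacus_gap B m .
  have "{b \<in> (+) s ` B. gaps_before ((+) s ` B) b \<noteq> 0} = (+) s ` {b \<in> B. gaps_before B b \<noteq> 0}"
    by (auto simp: gaps_before_shift)
  then show ?thesis
    unfolding partition_of_def beads_after_gap
    by (simp add: sorted_list_of_set_shift[OF finite_above] rev_map gaps_before_shift o_def)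
qed

text \<open>With a common partition, the descriptions of \<open>A\<close> and \<open>B\<close> by
  \<open>abacus_eq_partition\<close> differ only in the least gap, and the difference of the least
  gaps is the shift.\<close>

lemma partition_of_eq_imp_shift:
  assumes "is_abacus A" "is_abacus B" "partition_of A = partition_of B"
  obtains s where "B = (+) s ` A"
proof -
  obtain m where m: "abacus_gap A m"
    using is_abacus_imp_gap[OF assms(1)] .
  obtain m' where m': "abacus_gap B m'"
    using is_abacus_imp_gap[OF assms(2)] .
  define p where "p = partition_of A"
  have A: "A = {..<m} \<union> (\<lambda>i. int (p ! i) + m + int (length p) - 1 - int i) ` {..<length p}"
    using abacus_gap.abacus_eq_partition[OF m] unfolding p_def .
  have B: "B = {..<m'} \<union> (\<lambda>i. int (p ! i) + m' + int (length p) - 1 - int i) ` {..<length p}"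
    using abacus_gap.abacus_eq_partition[OF m'] unfolding p_def assms(3) .
  have "(+) (m' - m) ` {..<m} = {..<m'}"
    by (auto simp only: set_eq_iff mem_shift_iff lessThan_iff)
  then have "(+) (m' - m) ` A = B"
    unfolding A B image_Un image_image by (simp add: algebra_simps)
  then show ?thesis
    using that by blast
qed

text \<open>A hook length divisible by \<open>l\<close> would lead from a bead down to a gap on the
  same runner, which flushness excludes.\<close>

lemma is_core_partition_of:
  assumes "is_abacus B" and flush: "\<And>x c. x \<in> B \<Longrightarrow> x - int (l * c) \<in> B"
  shows "is_core l (partition_of B)"
proof -
  obtain m where "abacus_gap B m"
    using is_abacus_imp_gap[OF assms(1)] .
  then interpret abacus_gap B m .
  show ?thesis
    unfolding is_core_def
    using is_partition_partition_of hook_length_bead_gap flush by (metis dvdE)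
qed

section \<open>Abaci of integer vectors\<close>

lemma entry_div: "j < l \<Longrightarrow> entry l r j div int l = r"
  by (simp add: entry_def)

lemma entry_mod: "j < l \<Longrightarrow> entry l r j mod int l = int j"
  by (simp add: entry_def)

lemma entry_div_mod: "l > 0 \<Longrightarrow> entry l (x div int l) (nat (x mod int l)) = x"
  by (simp add: entry_def)

lemma mem_vec_abacus_iff:
  assumes "a \<noteq> []"
  shows "x \<in> vec_abacus a \<longleftrightarrow> x div int (length a) \<le> a ! nat (x mod int (length a))"
proof -
  have pos: "0 < length a"
    using assms by simp
  show ?thesis
  proof
    assume "x div int (length a) \<le> a ! nat (x mod int (length a))"
    moreover have "nat (x mod int (length a)) < length a"
      using pos by (simp add: nat_less_iff)
    ultimately show "x \<in> vec_abacus a"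
      unfolding vec_abacus_def using entry_div_mod[OF pos, of x, symmetric] by blast
  qed (auto simp: vec_abacus_def entry_div entry_mod)
qed

lemma entry_mem_vec_abacus_iff:
  assumes "j < length a"
  shows "entry (length a) r j \<in> vec_abacus a \<longleftrightarrow> r \<le> a ! j"
proof -
  have "a \<noteq> []"
    using assms by auto
  then show ?thesis
    using assms by (simp add: mem_vec_abacus_iff entry_div entry_mod)
qed

text \<open>Every level up to the smallest entry of \<open>a\<close> is full, and every level above
  the largest entry is empty.\<close>

lemma is_abacus_vec_abacus:
  assumes "a \<noteq> []"
  shows "is_abacus (vec_abacus a)"
proof -
  define n where "n = int (length a)"
  have n: "0 < n"
    using assms by (simp add: n_def)
  have mem: "a ! nat (x mod n) \<in> set a" for x
    using n by (intro nth_mem) (simp add: n_def nat_less_iff)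
  have "x \<in> vec_abacus a" if "x \<le> Min (set a) * n" for x
  proof -
    have "x div n \<le> Min (set a) * n div n"
      using that n by (intro zdiv_mono1)
    also have "\<dots> = Min (set a)"
      using n by simp
    also have "\<dots> \<le> a ! nat (x mod n)"
      using mem by simp
    finally show ?thesis
      using assms by (simp add: mem_vec_abacus_iff n_def)
  qed
  moreover have "x \<notin> vec_abacus a" if "x \<ge> (Max (set a) + 1) * n" for x
  proof -
    have "a ! nat (x mod n) \<le> Max (set a)"
      using mem by simp
    also have "\<dots> < (Max (set a) + 1) * n div n"
      using n by simp
    also have "\<dots> \<le> x div n"
      using that n by (intro zdiv_mono1)
    finally show ?thesis
      using assms by (simp add: mem_vec_abacus_iff n_def)
  qed
  ultimately show ?thesis
    unfolding is_abacus_def by blast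
qed

lemma vec_abacus_flush:
  assumes "a \<noteq> []" "x \<in> vec_abacus a"
  shows "x - int (length a * c) \<in> vec_abacus a"
proof -
  define n where "n = int (length a)"
  have n: "0 < n"
    using assms by (simp add: n_def)
  have x: "x - int (length a * c) = x + (- int c) * n"
    by (simp add: n_def)
  have "(x - int (length a * c)) div n = x div n - int c"
    unfolding x using n by (subst div_mult_self1) auto
  moreover have "(x - int (length a * c)) mod n = x mod n"
    unfolding x by (rule mod_mult_self1)
  ultimately show ?thesis
    using assms unfolding mem_vec_abacus_iff[OF assms(1)] n_def by simp
qed

text \<open>\<open>Phi\<close> is a restricted function, \<open>undefined\<close> outside
  \<open>cores_first\<close>, so this membership is what allows its value to be unfolded.\<close>

lemma vec_core_in_cores_first:
  assumes "a \<noteq> []" "k = first_part (vec_core a)"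
  shows "vec_core a \<in> cores_first (length a) k"
  using assms is_core_partition_of[OF is_abacus_vec_abacus vec_abacus_flush]
  by (simp add: cores_first_def vec_core_def)

lemma vec_abacus_inj:
  assumes "length a = length b" "vec_abacus a = vec_abacus b"
  shows "a = b"
proof (rule nth_equalityI)
  fix j assume j: "j < length a"
  have "r \<le> a ! j \<longleftrightarrow> r \<le> b ! j" for r
    using entry_mem_vec_abacus_iff[of j a r] entry_mem_vec_abacus_iff[of j b r] assms j by simp
  then show "a ! j = b ! j"
    by (meson order.antisym order.refl)
qed (rule assms)

section \<open>Rotation of vectors, and injectivity of \<open>vec_core\<close>\<close>

text \<open>The integer counterpart of \<open>psi\<close>: levels of an abacus are integers, while
  \<open>psi\<close> acts on real vectors.\<close>

definition rot :: "int list \<Rightarrow> int list" where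
  "rot a = (last a + 1) # butlast a"

lemma map_rot: "a \<noteq> [] \<Longrightarrow> map real_of_int (rot a) = psi (map real_of_int a)"
  by (simp add: rot_def psi_def last_map map_butlast)

lemma length_rot: "a \<noteq> [] \<Longrightarrow> length (rot a) = length a"
  by (simp add: rot_def)

lemma sum_list_rot: "a \<noteq> [] \<Longrightarrow> sum_list (rot a) = sum_list a + 1"
  by (induction a rule: rev_induct) (simp_all add: rot_def)

text \<open>Adding 1 moves a position to the next runner on the same level, except that the last
  runner passes to runner 0 one level higher. Hence the last entry comes to the front, increased by
  1.\<close>

lemma vec_abacus_rot:
  assumes "a \<noteq> []"
  shows "vec_abacus (rot a) = (+) 1 ` vec_abacus a"
proof -
  define n where "n = length a"
  have n: "0 < n" "length (rot a) = n" "rot a \<noteq> []"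
    using assms by (simp_all add: n_def rot_def)
  have "x \<in> vec_abacus (rot a) \<longleftrightarrow> x - 1 \<in> vec_abacus a" for x
  proof -
    define r j where "r = x div int n" and "j = nat (x mod int n)"
    have x: "x = entry n r j"
      using entry_div_mod n by (simp add: r_def j_def)
    have j: "j < n"
      using n by (simp add: j_def nat_less_iff)
    have L: "x \<in> vec_abacus (rot a) \<longleftrightarrow> r \<le> rot a ! j"
      using entry_mem_vec_abacus_iff[of j "rot a" r] n j x by simp
    show ?thesis
    proof (cases j)
      case 0
      then have "x - 1 = entry n (r - 1) (n - 1)"
        using n by (simp add: x entry_def algebra_simps of_nat_diff)
      then have "x - 1 \<in> vec_abacus a \<longleftrightarrow> r - 1 \<le> last a"
        using entry_mem_vec_abacus_iff[of "n - 1" a "r - 1"] n assms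
        by (simp add: n_def last_conv_nth)
      then show ?thesis
        using L 0 by (auto simp: rot_def)
    next
      case (Suc j')
      then have "x - 1 = entry n r j'"
        by (simp add: x entry_def)
      then have "x - 1 \<in> vec_abacus a \<longleftrightarrow> r \<le> a ! j'"
        using entry_mem_vec_abacus_iff[of j' a r] Suc j by (simp add: n_def)
      then show ?thesis
        using L Suc j by (simp add: rot_def nth_butlast n_def)
    qed
  qed
  then show ?thesis
    by (auto simp only: set_eq_iff mem_shift_iff)
qed

lemma rot_funpow:
  assumes "a \<noteq> []"
  shows "length ((rot ^^ n) a) = length a"
    and "sum_list ((rot ^^ n) a) = sum_list a + int n"
    and "vec_abacus ((rot ^^ n) a) = (+) (int n) ` vec_abacus a"
    and "map real_of_int ((rot ^^ n) a) = (psi ^^ n) (map real_of_int a)"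
proof (induction n)
  case (Suc n)
  have ne: "(rot ^^ n) a \<noteq> []"
    using Suc.IH(1) assms by (metis length_0_conv)
  case 1 then show ?case using Suc.IH(1) ne by (simp add: length_rot)
  case 2 then show ?case using Suc.IH(2) ne by (simp add: sum_list_rot)
  case 3 then show ?case
    using Suc.IH(3) ne by (simp add: vec_abacus_rot image_image add.assoc)
  case 4 then show ?case using Suc.IH(4) ne by (simp add: map_rot)
qed simp_all

text \<open>Equal cores give abaci that differ by a shift \<open>s\<close>. If
  \<open>s \<ge> 0\<close>, then \<open>s\<close> rotations realise this shift and raise the sum by
  \<open>s\<close>, so two zero sums force \<open>s = 0\<close>; for negative \<open>s\<close> the
  two vectors change roles. Injectivity is what allows \<open>core_vec\<close> to be evaluated by
  exhibiting a preimage.\<close>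

lemma vec_core_inj_on_zero_sum:
  assumes "n > 0"
  shows "inj_on vec_core (zero_sum_vectors n)"
proof -
  have *: "x = y" if xy: "length x = n" "length y = n" "sum_list x = 0" "sum_list y = 0"
    and s: "vec_abacus y = (+) s ` vec_abacus x" "s \<ge> 0" for x y s
  proof -
    have ne: "x \<noteq> []"
      using assms xy by auto
    have "vec_abacus y = vec_abacus ((rot ^^ nat s) x)"
      using rot_funpow(3)[OF ne, of "nat s"] s by simp
    then have y: "y = (rot ^^ nat s) x"
      using rot_funpow(1)[OF ne] xy by (intro vec_abacus_inj) simp_all
    then have "nat s = 0"
      using rot_funpow(2)[OF ne, of "nat s", folded y] xy by linarith
    then show ?thesis
      using y by (simp only: funpow_0)
  qed
  show ?thesis
  proof (rule inj_onI)
    fix x y assume "x \<in> zero_sum_vectors n" "y \<in> zero_sum_vectors n" and eq: "vec_core x = vec_core y"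
    then have xy: "length x = n" "length y = n" "sum_list x = 0" "sum_list y = 0"
      by (auto simp: zero_sum_vectors_def)
    then have "x \<noteq> []" "y \<noteq> []"
      using assms by auto
    then obtain s where s: "vec_abacus y = (+) s ` vec_abacus x"
      using partition_of_eq_imp_shift is_abacus_vec_abacus eq[unfolded vec_core_def] by blast
    then have s': "vec_abacus x = (+) (- s) ` vec_abacus y"
      by (simp add: image_image)
    show "x = y"
      using *[OF xy s] *[OF xy(2,1,4,3) s'] by (cases "0 \<le> s") auto
  qed
qed

section \<open>Deletion of a runner\<close>

lemma delete_runner_vec_abacus:
  assumes "i < length a"
  shows "delete_runner (length a) i (vec_abacus a) = vec_abacus (take i a @ drop (Suc i) a)"
proof -
  define c where "c = take i a @ drop (Suc i) a"
  have len: "length c = length a - 1"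
    using assms by (simp add: c_def)
  have "entry (length a) r (if j < i then j else Suc j) \<in> vec_abacus a \<longleftrightarrow> r \<le> c ! j"
    if "j < length a - 1" for r j
    using that assms by (subst entry_mem_vec_abacus_iff) (auto simp: c_def nth_append)
  then show ?thesis
    unfolding c_def[symmetric] delete_runner_def vec_abacus_def len by blast
qed

text \<open>A form of \<^const>\<open>delete_runner\<close> without case distinction, which makes the behaviour
  under shifts visible.\<close>
lemma delete_runner_eq_image:
  assumes "l \<ge> 2" "d < l"
  shows "delete_runner l d B
    = (\<lambda>x. x - 1 - (x - int d) div int l) ` {x \<in> B. x mod int l \<noteq> int d}"
proof -
  \<comment> \<open>An entry on level \<open>r\<close> moves down by \<open>r\<close>, and by one
    more if its runner lies to the right of \<open>d\<close>. The quotient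
    \<open>(x - int d) div int l\<close> is \<open>r - 1\<close> to the left of \<open>d\<close> and
    \<open>r\<close> to the right, so subtracting it and 1 fits both cases.\<close>
  define f where "f = (\<lambda>x. x - 1 - (x - int d) div int l)"
  have f: "f (entry l r (if j < d then j else Suc j)) = entry (l - 1) r j" if "j < l - 1" for r j
  proof (cases "j < d")
    case True
    have "(entry l r j - int d) = (int l + int j - int d) + (r - 1) * int l"
      by (simp add: entry_def algebra_simps)
    also have "\<dots> div int l = r - 1"
      using True assms by simp
    finally show ?thesis
      using True assms by (simp add: f_def entry_def algebra_simps of_nat_diff)
  next
    case False
    have "(entry l r (Suc j) - int d) = (int (Suc j) - int d) + r * int l"
      by (simp add: entry_def algebra_simps)
    also have "\<dots> div int l = r"
      using False that assms by simp
    finally show ?thesis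
      using False assms by (simp add: f_def entry_def algebra_simps of_nat_diff)
  qed
  have "{x \<in> B. x mod int l \<noteq> int d}
      = {entry l r (if j < d then j else Suc j) | r j.
          j < l - 1 \<and> entry l r (if j < d then j else Suc j) \<in> B}" (is "?L = ?R")
  proof (intro equalityI subsetI)
    fix x assume x: "x \<in> ?L"
    define r j where "r = x div int l" and "j = nat (x mod int l)"
    have xe: "x = entry l r j"
      using entry_div_mod[of l x] assms by (simp add: r_def j_def)
    have j: "j < l"
      using assms by (simp add: j_def nat_less_iff)
    have "j \<noteq> d"
      using x xe j entry_mod[of j l r] by auto
    define j' where "j' = (if j < d then j else j - 1)"
    have "j' < l - 1" "(if j' < d then j' else Suc j') = j"
      using j \<open>j \<noteq> d\<close> assms by (auto simp: j'_def)
    then show "x \<in> ?R"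
      using x xe by force
  next
    fix x assume "x \<in> ?R"
    then obtain r j where rj: "j < l - 1" "x = entry l r (if j < d then j else Suc j)" "x \<in> B"
      by blast
    then have "(if j < d then j else Suc j) < l"
      by auto
    then have "x mod int l = int (if j < d then j else Suc j)"
      unfolding rj(2) by (rule entry_mod)
    then show "x \<in> ?L"
      using rj(3) by auto
  qed
  then have "f ` {x \<in> B. x mod int l \<noteq> int d}
      = {f (entry l r (if j < d then j else Suc j)) | r j.
          j < l - 1 \<and> entry l r (if j < d then j else Suc j) \<in> B}"
    by (simp only:) blast
  also have "\<dots> = delete_runner l d B"
    unfolding delete_runner_def by (intro Collect_cong) (metis f)
  finally have "f ` {x \<in> B. x mod int l \<noteq> int d} = delete_runner l d B" .
  then show ?thesis
    by (simp add: f_def)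
qed

text \<open>Adding \<open>s\<close> maps the positions off the runner of \<open>x\<close> onto those
  off the runner of \<open>s + x\<close>. In the form of \<open>delete_runner_eq_image\<close>, the
  quotient then changes by a constant only.\<close>

lemma delete_runner_shift:
  assumes l: "l \<ge> 2"
  shows "\<exists>t. delete_runner l (nat ((s + x) mod int l)) ((+) s ` B)
    = (+) t ` delete_runner l (nat (x mod int l)) B"
proof -
  define n where "n = int l"
  have n: "n > 0"
    using l by (simp add: n_def)
  define d e where "d = x mod n" and "e = (s + x) mod n"
  \<comment> \<open>\<open>t\<close> is the number of levels by which \<open>x\<close> rises. Each
    of them costs one deleted entry, so the resulting shift is \<open>s - t\<close>.\<close>
  define t where "t = (s + x) div n - x div n"
  have e: "e = d + s - t * n"
    unfolding d_def e_def t_def by (simp add: minus_div_mult_eq_mod[symmetric] algebra_simps)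
  have bounds: "0 \<le> d" "d < n" "0 \<le> e" "e < n"
    using n by (simp_all add: d_def e_def)
  have "(s + y) mod n = e \<longleftrightarrow> y mod n = d" for y
  proof -
    have "(s + y) mod n = (s + x) mod n \<longleftrightarrow> y mod n = x mod n"
      by (simp add: mod_eq_dvd_iff)
    then show ?thesis
      by (simp add: d_def e_def)
  qed
  then have "{y \<in> (+) s ` B. y mod n \<noteq> e} = (+) s ` {y \<in> B. y mod n \<noteq> d}"
    by auto
  moreover have "s + y - 1 - (s + y - e) div n = (s - t) + (y - 1 - (y - d) div n)" for y
  proof -
    have "s + y - e = (y - d) + t * n"
      using e by simp
    then have "(s + y - e) div n = ((y - d) + t * n) div n"
      by (simp only:)
    also have "\<dots> = t + (y - d) div n"
      using n by (intro div_mult_self1) simp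
    finally have "(s + y - e) div n = t + (y - d) div n" .
    then show ?thesis
      by simp
  qed
  ultimately have "(\<lambda>y. y - 1 - (y - e) div n) ` {y \<in> (+) s ` B. y mod n \<noteq> e}
      = (+) (s - t) ` (\<lambda>y. y - 1 - (y - d) div n) ` {y \<in> B. y mod n \<noteq> d}"
    by (simp only: image_image)
  moreover have "delete_runner l (nat e) ((+) s ` B)
      = (\<lambda>y. y - 1 - (y - e) div n) ` {y \<in> (+) s ` B. y mod n \<noteq> e}"
    using delete_runner_eq_image[OF l, of "nat e"] bounds by (simp add: n_def nat_less_iff)
  moreover have "delete_runner l (nat d) B
      = (\<lambda>y. y - 1 - (y - d) div n) ` {y \<in> B. y mod n \<noteq> d}"
    using delete_runner_eq_image[OF l, of "nat d"] bounds by (simp add: n_def nat_less_iff)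
  ultimately show ?thesis
    unfolding d_def e_def n_def by auto
qed

section \<open>The largest bead and the value of \<open>Phi\<close>\<close>

text \<open>Positions are ordered by level first and by runner second. The largest bead is therefore
  on the highest occupied level and, there, on the rightmost possible runner; this is why the
  rightmost maximal entry is chosen.\<close>

lemma vec_abacus_le_max:
  assumes "i < length a" "a ! i = Max (set a)"
    and "\<forall>j. i < j \<and> j < length a \<longrightarrow> a ! j < a ! i"
    and "x \<in> vec_abacus a"
  shows "x \<le> entry (length a) (a ! i) i"
proof -
  obtain r j where x: "x = entry (length a) r j" "j < length a" "r \<le> a ! j"
    using assms(4) by (auto simp: vec_abacus_def)
  have "a ! j \<le> a ! i"
    using assms(2) x by simp
  show ?thesis
  proof (cases "r = a ! i")
    case True
    then have "j \<le> i"
      using assms(3) x by (meson leD linorder_le_less_linear)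
    then show ?thesis
      using True x by (simp add: entry_def)
  next
    case False
    then have "r + 1 \<le> a ! i"
      using \<open>a ! j \<le> a ! i\<close> x by linarith
    then have "(r + 1) * int (length a) \<le> a ! i * int (length a)"
      by (rule mult_right_mono) simp
    then show ?thesis
      using x by (simp add: entry_def algebra_simps)
  qed
qed

lemma sum_list_take_drop:
  fixes a :: "int list"
  assumes "i < length a"
  shows "sum_list (take i a @ drop (Suc i) a) = sum_list a - a ! i"
proof -
  have "sum_list a = sum_list (take i a @ a ! i # drop (Suc i) a)"
    by (rule arg_cong[OF id_take_nth_drop[OF assms]])
  then show ?thesis
    by simp
qed

text \<open>Every abacus of the core is a shift of \<open>vec_abacus a\<close>, and deletion turns
  each of these into a shift of \<open>vec_abacus c\<close>. So the \<open>THE\<close> in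
  \<open>Phi\<close> has exactly one candidate.\<close>

lemma Phi_vec_core:
  assumes "length a \<ge> 2" "k = first_part (vec_core a)"
    and i: "i < length a" "a ! i = Max (set a)"
    and "\<forall>j. i < j \<and> j < length a \<longrightarrow> a ! j < a ! i"
  shows "Phi (length a) k (vec_core a) = vec_core (take i a @ drop (Suc i) a)"
proof -
  define l where "l = length a"
  define A where "A = vec_abacus a"
  define M where "M = entry l (a ! i) i"
  define c where "c = take i a @ drop (Suc i) a"
  have a: "a \<noteq> []"
    using assms by auto
  have "length c = l - 1"
    using i by (simp add: c_def l_def)
  then have c: "c \<noteq> []"
    using assms(1) by (auto simp: l_def)
  have "M \<in> A"
    using i by (simp add: M_def A_def l_def entry_mem_vec_abacus_iff)
  have max: "x \<le> M" if "x \<in> A" for x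
    using vec_abacus_le_max[of i a x] assms that by (simp add: M_def A_def l_def)
  have "nat (M mod int l) = i"
    using i by (simp add: M_def l_def entry_mod)
  then have del: "delete_runner l (nat (M mod int l)) A = vec_abacus c"
    using delete_runner_vec_abacus[OF i(1)] by (simp add: A_def c_def l_def)
  \<comment> \<open>An arbitrary \<open>s\<close> serves both existence, with \<open>s = 0\<close>,
    and uniqueness, with the shift from \<open>partition_of_eq_imp_shift\<close>.\<close>
  have shift: "partition_of (delete_max_runner l ((+) s ` A)) = vec_core c" for s
  proof -
    have "largest_bead ((+) s ` A) = s + M"
      unfolding largest_bead_def
      by (rule Greatest_equality) (use \<open>M \<in> A\<close> max in auto)
    then obtain t where "delete_max_runner l ((+) s ` A) = (+) t ` vec_abacus c"
      using delete_runner_shift[of l s M A] assms(1) del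
      unfolding delete_max_runner_def l_def by metis
    then show ?thesis
      by (simp add: partition_of_shift is_abacus_vec_abacus c vec_core_def)
  qed
  have A: "is_abacus A" "partition_of A = vec_core a"
    using a by (simp_all add: A_def is_abacus_vec_abacus vec_core_def)
  have "(THE q. \<exists>B. is_abacus B \<and> partition_of B = vec_core a
      \<and> q = partition_of (delete_max_runner l B)) = vec_core c"
  proof (rule the_equality)
    show "\<exists>B. is_abacus B \<and> partition_of B = vec_core a
        \<and> vec_core c = partition_of (delete_max_runner l B)"
      using A shift[of 0] by (intro exI[of _ A]) simp
  next
    fix q assume "\<exists>B. is_abacus B \<and> partition_of B = vec_core a
        \<and> q = partition_of (delete_max_runner l B)"
    then show "q = vec_core c"
      using A shift partition_of_eq_imp_shift by metis
  qed
  moreover have "vec_core a \<in> cores_first l k"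
    using vec_core_in_cores_first a assms by (simp add: l_def)
  ultimately show ?thesis
    by (simp add: Phi_def c_def l_def)
qed

section \<open>Balancing the remaining vector\<close>

theorem theorem4p4p1p1:
  fixes l k i :: nat and a :: "int list"
  assumes "l \<ge> 2"
    and "length a = l"
    and "sum_list a = 0"
    and "k = first_part (vec_core a)"
    and "i < l"
    and "a ! i = Max (set a)"
    and "\<forall>j. i < j \<and> j < l \<longrightarrow> a ! j < a ! i"
  shows "map real_of_int (core_vec (l - 1) (Phi l k (vec_core a))) =
    (psi ^^ nat (a ! i)) (map real_of_int (take i a @ drop (Suc i) a))"
proof -
  define c where "c = take i a @ drop (Suc i) a"
  have len: "length c = l - 1"
    using assms by (simp add: c_def)
  then have c: "c \<noteq> []"
    using assms(1) by auto
  \<comment> \<open>The exponent is \<open>nat (a ! i)\<close>, which equals \<open>a ! i\<close>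
    only if the latter is nonnegative. A negative maximum would make the sum negative.\<close>
  have "a ! i \<ge> 0"
  proof (rule ccontr)
    assume "\<not> a ! i \<ge> 0"
    have neg: "x < 0" if "x \<in> set a" for x
      using Max_ge[OF finite_set that] \<open>\<not> a ! i \<ge> 0\<close> assms(6) by linarith
    have "sum_list a < 0"
      using neg assms(1,2) by (cases a) (auto intro!: add_neg_nonpos sum_list_nonpos dest: less_imp_le)
    then show False
      using assms(3) by simp
  qed
  \<comment> \<open>The vector \<open>c\<close> has sum \<open>- (a ! i)\<close>, so this number of
    rotations brings the sum to 0. They only shift the abacus, so \<open>v\<close> is the balanced
    vector with the core of \<open>c\<close>.\<close>
  define v where "v = (rot ^^ nat (a ! i)) c"
  have "sum_list c = - (a ! i)"
    using sum_list_take_drop[of i a] assms by (simp add: c_def)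
  then have v: "v \<in> zero_sum_vectors (l - 1)"
    using rot_funpow(1,2)[OF c, of "nat (a ! i)"] len \<open>a ! i \<ge> 0\<close>
    by (simp add: v_def zero_sum_vectors_def)
  have "vec_core v = vec_core c"
    using rot_funpow(3)[OF c] c
    by (simp add: v_def vec_core_def partition_of_shift is_abacus_vec_abacus)
  also have "\<dots> = Phi l k (vec_core a)"
    using Phi_vec_core[of a k i] assms by (simp add: c_def)
  finally have "core_vec (l - 1) (Phi l k (vec_core a)) = v"
    unfolding core_vec_def using the_inv_into_f_f[OF vec_core_inj_on_zero_sum v] assms(1) by simp
  then show ?thesis
    using rot_funpow(4)[OF c] by (simp add: v_def c_def)
qed

end
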